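(* Let $p$ and $q$ be distinct prime numbers, let $l$ be a positive integer such that $q \mid p^{l}-1$, and let $r$ be the largest positive integer such that $q^{r}\mid p^{l}-1$; write $p^{l}-1 = m q^{r}$ with $\gcd(m,q)=1$. Let $F$ be a finite field with $p^{l}$ elements, let $\xi\in F$ be a primitive $q^{r}$-th root of $1$, and let $s$ be a positive integer with $s\le r$. Let $\widehat{F} = F[\alpha]/(\alpha^{q^{s}}-\xi)$ (the polynomial $x^{q^s}-\xi$ being irreducible in $F[x]$), let $\zeta = \xi^{m q^{r-s}}$, let $b\in F\setminus\{0\}$ be such that $b^{q^{s}}\ne\xi$, and let $\gamma = (\alpha-b)^{-1}$. Then $\gamma$ is a normal element in $\widehat{F}$ over $F$, that is, $\{\gamma^{p^{il}} : 0\le i\le q^{s}-1\}$ is a basis of $\widehat{F}$ over $F$; moreover, for $1\le i\le q^{s}-1$, one has $\zeta^{i}\neq 1$ and $$(\zeta^{i}-1)\,b\,\gamma^{1+p^{il}} = \gamma - \zeta^{i}\gamma^{p^{il}},$$ and $$\sum_{i=0}^{q^{s}-1}\gamma^{p^{il}} = -q^{s}\,b^{q^{s}-1}\,(b^{q^{s}}-\xi)^{-1}.$$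
   Context: In $\widehat{F} = F[\alpha]/(\alpha^{q^{s}}-\xi)$, $\alpha$ also denotes the residue class of the indeterminate, so $\alpha\in\widehat{F}$ satisfies $\alpha^{q^s}=\xi$. *)

theory Defs
  imports "HOL-Algebra.Algebra"
begin

definition primitive_root_of_unity :: "('a, 'b) ring_scheme \<Rightarrow> nat \<Rightarrow> 'a \<Rightarrow> bool" where
  "primitive_root_of_unity F n x \<longleftrightarrow>
     x \<in> carrier F \<and> n > 0 \<and> x [^]\<^bsub>F\<^esub> n = \<one>\<^bsub>F\<^esub> \<and>
     (\<forall>k::nat. 0 < k \<and> k < n \<longrightarrow> x [^]\<^bsub>F\<^esub> k \<noteq> \<one>\<^bsub>F\<^esub>)"

definition binomial_poly :: "('a, 'b) ring_scheme \<Rightarrow> nat \<Rightarrow> 'a \<Rightarrow> 'a list" where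
  "binomial_poly F n c =
     (X\<^bsub>F\<^esub> [^]\<^bsub>poly_ring F\<^esub> n) \<ominus>\<^bsub>poly_ring F\<^esub> ring.poly_of_const F c"

text \<open>\<open>Rupt\<close> is the quotient of \<open>poly_ring F\<close> by the principal ideal generated by the given
  polynomial. The two maps below are the residue class of a constant, i.e. the structure map from
  \<open>F\<close> into this quotient, and the residue class of the indeterminate.\<close>

definition quot_const :: "('a, 'b) ring_scheme \<Rightarrow> 'a list \<Rightarrow> 'a \<Rightarrow> 'a list set" where
  "quot_const F f a = (PIdl\<^bsub>poly_ring F\<^esub> f) +>\<^bsub>poly_ring F\<^esub> ring.poly_of_const F a"

definition quot_var :: "('a, 'b) ring_scheme \<Rightarrow> 'a list \<Rightarrow> 'a list set" where
  "quot_var F f = (PIdl\<^bsub>poly_ring F\<^esub> f) +>\<^bsub>poly_ring F\<^esub> X\<^bsub>F\<^esub>"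

text \<open>A basis is a list, i.e. an indexed family: \<open>ring.independent\<close> forces its entries to
  be pairwise distinct.\<close>

definition is_basis :: "('c, 'd) ring_scheme \<Rightarrow> 'c set \<Rightarrow> 'c list \<Rightarrow> bool" where
  "is_basis E K vs \<longleftrightarrow>
     set vs \<subseteq> carrier E \<and> ring.independent E K vs \<and> ring.Span E K vs = carrier E"

text \<open>For an extension \<open>E\<close> of degree \<open>n\<close> of a finite field \<open>K\<close>, the conjugates of an element
  over \<open>K\<close> are its images under the powers \<open>0, \<dots>, n - 1\<close> of the Frobenius map
  \<open>x \<mapsto> x ^ card K\<close>.\<close>

definition normal_element :: "('c, 'd) ring_scheme \<Rightarrow> 'c set \<Rightarrow> 'c \<Rightarrow> bool" where
  "normal_element E K x \<longleftrightarrow>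
     x \<in> carrier E \<and>
     (\<exists>n. ring.dimension E n K (carrier E) \<and>
          is_basis E K (map (\<lambda>i. x [^]\<^bsub>E\<^esub> (card K ^ i)) [0..<n]))"

end

(* Write n = q^s and N = p^l = 1 + n M. Over F, the relation \<alpha>^n = \<xi> gives \<alpha>^N = \<zeta> \<alpha> with
   \<zeta> = \<xi>^M of order exactly n.

   Irreducibility of x^n - \<xi>: in the quotient by an irreducible divisor of degree d, every x
   satisfies x^(N^d) = x, while \<alpha>^(N^d) = \<zeta>^d \<alpha>; hence \<zeta>^d = 1 and d \<ge> n.

   Normality: the conjugates of \<gamma> are \<gamma>_i = 1 / (\<zeta>^i \<alpha> - b). Expanding them by the geometric sum for
   (\<zeta>^i \<alpha>)^n - b^n = \<xi> - b^n and summing over i leaves only the constant term, which is the trace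
   formula. The trace is a nonzero element of F, so the span of the \<gamma>_i contains 1; as
   \<zeta>^i \<alpha> \<gamma>_i = 1 + b \<gamma>_i, this span is closed under multiplication by \<alpha>, hence it is the whole
   extension, and n spanning elements of an n-dimensional space form a basis. *)
theory Submission
  imports Defs
begin

section \<open>Rings, finite fields and spans\<close>

lemma (in cring) binomial_theorem:
  assumes "x \<in> carrier R" "y \<in> carrier R"
  shows "(x \<oplus> y) [^] n = (\<Oplus>k\<in>{..n}. add_pow R (n choose k) (x [^] k \<otimes> y [^] (n - k)))"
proof (induction n)
  case 0
  then show ?case using assms by simp
next
  case (Suc n)
  let ?t = "\<lambda>k. x [^] k \<otimes> y [^] (Suc n - k)"
  have t: "?t k \<in> carrier R" for k
    using assms by simp
  have X: "x \<otimes> (\<Oplus>k\<in>{..n}. add_pow R (n choose k) (x [^] k \<otimes> y [^] (n - k)))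
      = (\<Oplus>k\<in>{..n}. add_pow R (n choose k) (?t (Suc k)))"
    using assms by (subst finsum_rdistr)
      (auto intro!: finsum_cong' simp: add_pow_rdistr m_ac)
  have "y \<otimes> (\<Oplus>k\<in>{..n}. add_pow R (n choose k) (x [^] k \<otimes> y [^] (n - k)))
      = (\<Oplus>k\<in>{..n}. add_pow R (n choose k) (?t k))"
    using assms by (subst finsum_rdistr)
      (auto intro!: finsum_cong' simp: add_pow_rdistr Suc_diff_le m_ac)
  \<comment> \<open>The extra term has coefficient \<open>n choose Suc n = 0\<close>. The longer
    range allows the term \<open>k = 0\<close> to be split off, so that both sums run over the terms
    \<open>?t (Suc k)\<close> and Pascal's rule applies.\<close>
  also have "\<dots> = (\<Oplus>k\<in>{..Suc n}. add_pow R (n choose k) (?t k))"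
    using assms by (subst finsum_Suc) (auto simp: binomial_eq_0)
  also have "\<dots> = (\<Oplus>k\<in>{..n}. add_pow R (n choose Suc k) (?t (Suc k))) \<oplus> ?t 0"
    using t assms by (subst finsum_Suc2) auto
  finally have Y: "y \<otimes> (\<Oplus>k\<in>{..n}. add_pow R (n choose k) (x [^] k \<otimes> y [^] (n - k)))
      = (\<Oplus>k\<in>{..n}. add_pow R (n choose Suc k) (?t (Suc k))) \<oplus> ?t 0" .
  have "(x \<oplus> y) [^] Suc n = x \<otimes> (x \<oplus> y) [^] n \<oplus> y \<otimes> (x \<oplus> y) [^] n"
    using assms by (simp add: nat_pow_Suc m_comm l_distr)
  also have "\<dots> = (\<Oplus>k\<in>{..n}. add_pow R (n choose k) (?t (Suc k)))
      \<oplus> (\<Oplus>k\<in>{..n}. add_pow R (n choose Suc k) (?t (Suc k))) \<oplus> ?t 0"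
    unfolding Suc X Y using t assms by (subst a_assoc) (auto intro!: finsum_closed)
  also have "\<dots> = (\<Oplus>k\<in>{..n}. add_pow R (Suc n choose Suc k) (?t (Suc k))) \<oplus> ?t 0"
    using assms by (subst finsum_addf[symmetric])
      (auto intro!: arg_cong2[where f = "(\<oplus>)"] finsum_cong' simp: add.nat_pow_mult)
  also have "\<dots> = (\<Oplus>k\<in>{..Suc n}. add_pow R (Suc n choose k) (?t k))"
    using t assms by (subst finsum_Suc2) auto
  finally show ?case .
qed

text \<open>The inner binomial coefficients are multiples of \<open>p\<close> and vanish in the
  ring, so only the two outer terms of the expansion remain.\<close>

lemma (in cring) add_power_prime_char:
  fixes p :: nat
  assumes "Factorial_Ring.prime p" and char: "add_pow R p \<one> = \<zero>"
    and "x \<in> carrier R" "y \<in> carrier R"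
  shows "(x \<oplus> y) [^] p = x [^] p \<oplus> y [^] p"
proof -
  obtain N where N: "p = Suc N" and "p > 1"
    using prime_gt_1_nat[OF assms(1)] by (cases p) auto
  have kill: "add_pow R (p * j) z = \<zero>" if "z \<in> carrier R" for j z
  proof -
    have "add_pow R p z = (add_pow R p \<one>) \<otimes> z"
      using that by (subst add_pow_ldistr) auto
    then have "add_pow R p z = \<zero>" using that char by simp
    then show ?thesis using that by (subst add.nat_pow_pow[symmetric]) (auto simp: add.nat_pow_one)
  qed
  have van: "add_pow R (p choose Suc k) z = \<zero>" if "z \<in> carrier R" "k < N" for k z
    using dvd_choose_prime[of "Suc k" p] assms(1) kill that N by (auto simp: dvd_def)
  let ?t = "\<lambda>k. x [^] k \<otimes> y [^] (p - k)"
  have t: "?t k \<in> carrier R" for k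
    using assms by simp
  have "(x \<oplus> y) [^] p = (\<Oplus>k\<in>{..Suc N}. add_pow R (p choose k) (?t k))"
    using binomial_theorem[OF assms(3,4), of p] N by simp
  also have "\<dots> = (\<Oplus>k\<in>{..N}. add_pow R (p choose Suc k) (?t (Suc k))) \<oplus> ?t 0"
    using t assms by (subst finsum_Suc2) auto
  also have "(\<Oplus>k\<in>{..N}. add_pow R (p choose Suc k) (?t (Suc k))) = ?t p"
  proof (cases N)
    case 0 then show ?thesis using \<open>p > 1\<close> N by simp
  next
    case (Suc M)
    have "(\<Oplus>k\<in>{..M}. add_pow R (p choose Suc k) (?t (Suc k))) = (\<Oplus>k\<in>{..M}. \<zero>)"
      using t van assms(3,4) Suc by (intro finsum_cong') auto
    then show ?thesis unfolding Suc using t assms N Suc by (subst finsum_Suc) auto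
  qed
  finally show ?thesis using assms by simp
qed

lemma (in cring) add_power_prime_power_char:
  fixes p :: nat
  assumes "Factorial_Ring.prime p" "add_pow R p \<one> = \<zero>"
    and "x \<in> carrier R" "y \<in> carrier R"
  shows "(x \<oplus> y) [^] (p ^ k) = x [^] (p ^ k) \<oplus> y [^] (p ^ k)"
proof (induction k)
  case (Suc k)
  have "z [^] (p ^ Suc k) = (z [^] (p ^ k)) [^] p" if "z \<in> carrier R" for z
    using that nat_pow_pow[of z "p ^ k" p] by (simp add: mult.commute)
  then show ?case using Suc assms by (simp add: add_power_prime_char)
qed (use assms in simp)

text \<open>Additivity is applied to \<open>x = (x \<ominus> y) \<oplus> y\<close>; this avoids the
  sign of a power of a negative and with it a case distinction on the parity of
  \<open>p\<close>.\<close>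

lemma (in cring) minus_power_prime_power_char:
  fixes p :: nat
  assumes "Factorial_Ring.prime p" "add_pow R p \<one> = \<zero>"
    and x: "x \<in> carrier R" and y: "y \<in> carrier R"
  shows "(x \<ominus> y) [^] (p ^ k) = x [^] (p ^ k) \<ominus> y [^] (p ^ k)"
proof -
  have "x [^] (p ^ k) = (x \<ominus> y) [^] (p ^ k) \<oplus> y [^] (p ^ k)"
    using add_power_prime_power_char[OF assms(1,2), of "x \<ominus> y" y k] x y
    by (simp add: minus_eq a_assoc l_neg)
  then show ?thesis
    using x y nat_pow_closed[OF x, of "p ^ k"] nat_pow_closed[OF y, of "p ^ k"]
      nat_pow_closed[OF minus_closed[OF x y], of "p ^ k"]
    by algebra
qed

text \<open>Serves twice: with \<open>y = \<one>\<close> for sums of powers of a root of unity, and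
  with \<open>x\<close> a conjugate of \<alpha> to expand the inverse of
  \<open>x \<ominus> b\<close>.\<close>

lemma (in cring) power_sub_eq_geometric:
  assumes "x \<in> carrier R" "y \<in> carrier R"
  shows "(x \<ominus> y) \<otimes> (\<Oplus>k\<in>{..n}. x [^] k \<otimes> y [^] (n - k)) = x [^] Suc n \<ominus> y [^] Suc n"
proof (induction n)
  case 0
  then show ?case using assms by simp
next
  case (Suc n)
  let ?G = "\<lambda>n. \<Oplus>k\<in>{..n}. x [^] k \<otimes> y [^] (n - k)"
  have G: "?G n \<in> carrier R" using assms by (auto intro!: finsum_closed)
  have "(\<Oplus>k\<in>{..n}. x [^] k \<otimes> y [^] (Suc n - k)) = y \<otimes> ?G n"
    using assms by (subst finsum_rdistr)
      (auto intro!: finsum_cong' simp: Suc_diff_le m_ac)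
  then have "?G (Suc n) = x [^] Suc n \<oplus> y \<otimes> ?G n"
    using assms by (subst finsum_Suc) auto
  then have "(x \<ominus> y) \<otimes> ?G (Suc n) = (x \<ominus> y) \<otimes> x [^] Suc n \<oplus> y \<otimes> ((x \<ominus> y) \<otimes> ?G n)"
    using assms G by (simp add: r_distr m_lcomm)
  also have "\<dots> = (x \<ominus> y) \<otimes> x [^] Suc n \<oplus> y \<otimes> (x [^] Suc n \<ominus> y [^] Suc n)"
    unfolding Suc ..
  also have "\<dots> = x \<otimes> x [^] Suc n \<ominus> y \<otimes> y [^] Suc n"
    using assms nat_pow_closed[OF assms(1), of "Suc n"] nat_pow_closed[OF assms(2), of "Suc n"] by algebra
  finally show ?case using assms by (simp add: m_comm)
qed

lemma (in abelian_monoid) finsum_swap_atMost: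
  assumes "\<And>i k. f i k \<in> carrier G"
  shows "(\<Oplus>i\<in>{..m::nat}. \<Oplus>k\<in>{..n::nat}. f i k) = (\<Oplus>k\<in>{..n}. \<Oplus>i\<in>{..m}. f i k)"
  by (induction n) (use assms in \<open>auto simp: finsum_addf intro!: finsum_cong'\<close>)

section \<open>Counting elements of finite fields and of their finite-dimensional spaces\<close>

lemma (in field) power_card_eq_self:
  assumes "finite (carrier R)" "x \<in> carrier R"
  shows "x [^] card (carrier R) = x"
proof (cases "x = \<zero>")
  case True
  have "card (carrier R) > 0"
    using assms by (auto simp: card_gt_0_iff)
  then show ?thesis using True by (simp add: nat_pow_zero)
next
  case False
  \<comment> \<open>Lagrange's theorem in the group of units gives exponent
    \<open>card (Units R)\<close>; the one missing factor is \<open>x\<close> itself.\<close>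
  have "card (carrier R) = Suc (card (Units R))"
    using assms unfolding field_Units by (metis card_Suc_Diff1 zero_closed)
  moreover have "x [^] card (Units R) = \<one>"
    using False assms by (intro units_power_order_eq_one) (auto simp: field_Units)
  ultimately show ?thesis using assms by simp
qed

text \<open>Each dimension step adjoins a vector \<open>v\<close> outside \<open>E\<close>, and
  every element of the new space is \<open>k \<otimes> v \<oplus> e\<close> for exactly one pair
  \<open>(k, e)\<close>, so the cardinality is multiplied by \<open>card K\<close>.\<close>

lemma (in ring) card_of_dimension:
  assumes "subfield K R" "finite K" "dimension n K V"
  shows "finite V \<and> card V = card K ^ n"
  using assms(3,1,2)
proof (induction n K V rule: dimension.induct)
  case (Suc_dim v E n K)
  note K_fin = Suc_dim.prems
  note E = space_subgroup_props[OF K_fin(1) Suc_dim(3)]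
  have K: "K \<subseteq> carrier R" using subfieldE(3)[OF K_fin(1)] .
  let ?g = "\<lambda>(k, e). k \<otimes> v \<oplus> e"
  have "inj_on ?g (K \<times> E)"
  proof (rule inj_onI, clarify)
    fix k e k' e' assume A: "k \<in> K" "e \<in> E" "k' \<in> K" "e' \<in> E" "k \<otimes> v \<oplus> e = k' \<otimes> v \<oplus> e'"
    then have C: "k \<in> carrier R" "k' \<in> carrier R" "e \<in> carrier R" "e' \<in> carrier R"
      using K E(1) by auto
    have "(k \<ominus> k') \<otimes> v = e' \<ominus> e"
    proof -
      have "(k \<ominus> k') \<otimes> v = (k \<otimes> v \<oplus> e) \<ominus> e \<ominus> k' \<otimes> v" using C Suc_dim(1) by algebra
      also have "\<dots> = e' \<ominus> e" unfolding A(5) using C Suc_dim(1) by algebra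
      finally show ?thesis .
    qed
    moreover have "e' \<ominus> e \<in> E" using A E by (simp add: minus_eq)
    moreover have "k \<ominus> k' \<in> K"
      using A subringE(5,7)[OF subfieldE(1)[OF K_fin(1)]] by (simp add: minus_eq)
    \<comment> \<open>A nonzero scalar could be divided out, which would put \<open>v\<close> into
      \<open>E\<close>.\<close>
    ultimately have "k \<ominus> k' = \<zero>"
      using E(6)[of "k \<ominus> k'" v] Suc_dim(1,2) by auto
    then have "k = k'" using C by simp
    then show "k = k' \<and> e = e'" using A(5) C Suc_dim(1) by simp
  qed
  moreover have "?g ` (K \<times> E) = line_extension K v E"
    by (force simp: line_extension_mem_iff image_iff)
  ultimately have "bij_betw ?g (K \<times> E) (line_extension K v E)"
    by (simp add: bij_betw_def)
  from bij_betw_same_card[OF this] bij_betw_finite[OF this]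
  have "finite (line_extension K v E) \<and> card (line_extension K v E) = card K * card E"
    using Suc_dim.IH[OF K_fin] K_fin(2) by (simp add: card_cartesian_product)
  then show ?case using Suc_dim.IH[OF K_fin] by simp
qed simp

section \<open>Spans, and bases among spanning lists of the right length\<close>

lemma (in ring) finsum_in_Span:
  assumes "subfield K R" "set vs \<subseteq> carrier R" "finite I" "\<And>i. i \<in> I \<Longrightarrow> f i \<in> Span K vs"
  shows "(\<Oplus>i\<in>I. f i) \<in> Span K vs"
  using assms(3,4)
proof (induction I)
  case (insert i I)
  then have "f \<in> insert i I \<rightarrow> carrier R"
    using Span_subgroup_props(1)[OF assms(1,2)] by auto
  then show ?case
    using insert Span_subgroup_props(3)[OF assms(1,2)] by (subst finsum_insert) auto
qed (use Span_subgroup_props(2)[OF assms(1,2)] in simp)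

text \<open>A vector already in the span of the later ones does not change the span, and any other
  raises the dimension by one. The dimension thus reaches the length only if no vector is redundant,
  which is independence.\<close>

lemma (in ring) Span_dimension_le:
  assumes "subfield K R" "set vs \<subseteq> carrier R"
  shows "\<exists>m \<le> length vs. dimension m K (Span K vs) \<and> (m = length vs \<longrightarrow> independent K vs)"
  using assms(2)
proof (induction vs)
  case (Cons v vs)
  then obtain m where m: "m \<le> length vs" "dimension m K (Span K vs)"
    "m = length vs \<longrightarrow> independent K vs" by auto
  show ?case
  proof (cases "v \<in> Span K vs")
    case True
    have "Span K (v # vs) \<subseteq> Span K vs"
      using True Cons.prems Span_base_incl[OF assms(1), of vs]
      by (intro mono_Span_subset[OF assms(1)]) auto
    then have "Span K (v # vs) = Span K vs"
      using mono_Span[OF assms(1), of vs v] Cons.prems by auto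
    then show ?thesis using m by (intro exI[of _ m]) auto
  next
    case False
    then show ?thesis
      using m Cons.prems Suc_dim[OF _ False m(2)] li_Cons[OF _ False] by (intro exI[of _ "Suc m"]) auto
  qed
qed auto

lemma (in ring) is_basis_if_Span_dimension:
  assumes "subfield K R" "dimension n K (carrier R)"
    and "set vs \<subseteq> carrier R" "length vs = n" "Span K vs = carrier R"
  shows "is_basis R K vs"
proof -
  have "independent K vs"
    using Span_dimension_le[OF assms(1,3)] dimension_is_inj[OF assms(1,2)] assms(4,5) by auto
  then show ?thesis using assms by (simp add: is_basis_def)
qed

text \<open>Since \<open>z\<close> is fixed by the \<open>N\<close>-th power map, each further
  application contributes exactly one more factor \<open>z\<close>.\<close>

lemma (in cring) power_twist:
  assumes "x \<in> carrier R" "z \<in> carrier R" "z [^] (N::nat) = z" "x [^] N = z \<otimes> x"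
  shows "x [^] (N ^ i) = z [^] i \<otimes> x"
proof (induction i)
  case (Suc i)
  have "x [^] (N ^ Suc i) = (x [^] (N ^ i)) [^] N"
    using assms by (simp add: nat_pow_pow mult.commute)
  also have "\<dots> = (z [^] N) [^] i \<otimes> x [^] N"
    using Suc assms(1,2) by (simp add: nat_pow_distrib nat_pow_pow mult.commute del: nat_pow_Suc)
  finally show ?case unfolding assms(3,4) using assms(1,2) by (simp add: m_ac)
qed (use assms in simp)

lemma (in comm_monoid) m_rcomm:
  "x \<in> carrier G \<Longrightarrow> y \<in> carrier G \<Longrightarrow> z \<in> carrier G \<Longrightarrow> x \<otimes> y \<otimes> z = x \<otimes> z \<otimes> y"
  by (simp add: m_ac)

lemma (in comm_monoid) inv_nat_pow:
  assumes "u \<in> Units G" shows "inv u [^] (k::nat) = inv (u [^] k)"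
proof -
  have "u [^] k \<otimes> inv u [^] k = (u \<otimes> inv u) [^] k"
    using assms by (intro nat_pow_distrib[symmetric]) auto
  also have "\<dots> = \<one>" using assms by simp
  finally show ?thesis using assms by (intro comm_inv_char[symmetric]) auto
qed

lemma (in domain) nat_pow_nonzero:
  "x \<in> carrier R \<Longrightarrow> x \<noteq> \<zero> \<Longrightarrow> x [^] (k::nat) \<noteq> \<zero>"
  by (induction k) (auto simp: integral_iff)

section \<open>The quotient by a divisor of a binomial\<close>

context field
begin

section \<open>The polynomial ring and the degree of a binomial\<close>

lemma poly_ring_domain: "domain (poly_ring R)"
  by (rule univ_poly_is_domain[OF carrier_is_subring])

lemma const_hom: "ring_hom_ring R (poly_ring R) poly_of_const"
  using canonical_embedding_ring_hom[OF carrier_is_subring] by simp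

lemma const_closed: "c \<in> carrier R \<Longrightarrow> poly_of_const c \<in> carrier (poly_ring R)"
  using ring_hom_ring.homh[OF const_hom] by (rule ring_hom_memE(1))

lemma binomial_poly_closed:
  assumes "c \<in> carrier R" shows "binomial_poly R n c \<in> carrier (poly_ring R)"
proof -
  interpret P: domain "poly_ring R" by (rule poly_ring_domain)
  show ?thesis
    unfolding binomial_poly_def
    using var_pow_closed[OF carrier_is_subring, of n] const_closed[OF assms] by (rule P.minus_closed)
qed

lemma degree_binomial_poly:
  assumes "c \<in> carrier R" "n > 0" shows "degree (binomial_poly R n c) = n"
proof -
  interpret P: domain "poly_ring R" by (rule poly_ring_domain)
  let ?m = "\<ominus>\<^bsub>poly_ring R\<^esub> poly_of_const c"
  have X: "X [^]\<^bsub>poly_ring R\<^esub> n = monom \<one> n"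
    by (rule unitary_monom_eq_var_pow[OF carrier_is_subring, symmetric])
  have m: "?m \<in> carrier (poly_ring R)" using const_closed[OF assms(1)] by simp
  \<comment> \<open>This includes \<open>c = \<zero>\<close>, where the polynomial is the empty list
    and \<open>degree\<close> is still 0.\<close>
  have "degree (poly_of_const c) = 0" by (auto simp: poly_of_const_def)
  then have "degree ?m = 0"
    using univ_poly_a_inv_degree[OF carrier_is_subring const_closed[OF assms(1)]] by simp
  moreover have "degree (monom \<one> n) = n" by (simp add: monom_def)
  moreover have "polynomial (carrier R) (monom \<one> n)" "polynomial (carrier R) ?m"
    using m var_pow_closed[OF carrier_is_subring, of n] by (auto simp: X univ_poly_carrier)
  ultimately have "degree (poly_add (monom \<one> n) ?m) = n"
    using poly_add_degree_eq[OF carrier_is_subring, of "monom \<one> n" ?m] assms(2) by simp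
  then show ?thesis by (simp add: binomial_poly_def P.minus_eq X univ_poly_add)
qed

section \<open>The quotient by an arbitrary \<open>g\<close>, used for irreducible divisors of the
  binomial and for the binomial itself\<close>

context
  fixes g assumes g: "g \<in> carrier (poly_ring R)"
begin

lemma quot_hom:
  "ring_hom_ring (poly_ring R) (Rupt (carrier R) g) (rupture_surj (carrier R) g)"
  by (rule rupture_surj_hom(2)[OF carrier_is_subring g])

lemma quot_const_eq: "quot_const R g = rupture_surj (carrier R) g \<circ> poly_of_const"
  by (simp add: quot_const_def fun_eq_iff)

lemma quot_const_hom: "ring_hom_ring R (Rupt (carrier R) g) (quot_const R g)"
proof -
  interpret H: ring_hom_ring "poly_ring R" "Rupt (carrier R) g" "rupture_surj (carrier R) g"
    by (rule quot_hom)
  have "quot_const R g \<in> ring_hom R (Rupt (carrier R) g)"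
    unfolding quot_const_eq
    by (rule ring_hom_trans[OF ring_hom_ring.homh[OF const_hom] H.homh])
  then show ?thesis using ring_axioms H.S.ring_axioms by (intro ring_hom_ringI2)
qed

lemma quot_var_closed: "quot_var R g \<in> carrier (Rupt (carrier R) g)"
  using ring_hom_memE(1)[OF ring_hom_ring.homh[OF quot_hom] var_closed(1)[OF carrier_is_subring]]
  by (simp add: quot_var_def)

lemma quot_dvd_eq_zero:
  assumes "f \<in> carrier (poly_ring R)" "g pdivides f"
  shows "rupture_surj (carrier R) g f = \<zero>\<^bsub>Rupt (carrier R) g\<^esub>"
proof -
  interpret P: domain "poly_ring R" by (rule poly_ring_domain)
  interpret H: ring_hom_ring "poly_ring R" "Rupt (carrier R) g" "rupture_surj (carrier R) g"
    by (rule quot_hom)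
  obtain h where h: "h \<in> carrier (poly_ring R)" "f = g \<otimes>\<^bsub>poly_ring R\<^esub> h"
    using assms(2) unfolding pdivides_def factor_def by (elim bexE) (rule that)
  have "rupture_surj (carrier R) g g = \<zero>\<^bsub>Rupt (carrier R) g\<^esub>"
    using P.a_rcos_zero[OF P.cgenideal_ideal[OF g] P.cgenideal_self[OF g]]
    unfolding rupture_def FactRing_def by simp
  moreover have "rupture_surj (carrier R) g f = rupture_surj (carrier R) g g
      \<otimes>\<^bsub>Rupt (carrier R) g\<^esub> rupture_surj (carrier R) g h"
    unfolding h(2) by (rule H.hom_mult[OF g h(1)])
  ultimately show ?thesis using H.S.l_null[OF H.hom_closed[OF h(1)]] by metis
qed

text \<open>The two sides differ by the class of the binomial, which is a multiple of
  \<open>g\<close> and hence zero.\<close>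

lemma quot_var_pow:
  assumes "c \<in> carrier R" "g pdivides binomial_poly R n c"
  shows "quot_var R g [^]\<^bsub>Rupt (carrier R) g\<^esub> n = quot_const R g c"
proof -
  interpret P: domain "poly_ring R" by (rule poly_ring_domain)
  interpret H: ring_hom_ring "poly_ring R" "Rupt (carrier R) g" "rupture_surj (carrier R) g"
    by (rule quot_hom)
  have X: "X \<in> carrier (poly_ring R)" by (rule var_closed(1)[OF carrier_is_subring])
  note XN = P.nat_pow_closed[OF X, of n] and c = const_closed[OF assms(1)]
  have "rupture_surj (carrier R) g (X [^]\<^bsub>poly_ring R\<^esub> n \<ominus>\<^bsub>poly_ring R\<^esub> poly_of_const c)
      = \<zero>\<^bsub>Rupt (carrier R) g\<^esub>"
    using quot_dvd_eq_zero[OF binomial_poly_closed[OF assms(1)] assms(2)]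
    by (simp add: binomial_poly_def)
  then have "rupture_surj (carrier R) g (X [^]\<^bsub>poly_ring R\<^esub> n) = rupture_surj (carrier R) g (poly_of_const c)"
    using H.hom_closed[OF XN] H.hom_closed[OF c] XN c
    by (simp only: P.minus_eq H.hom_add H.hom_a_inv P.a_inv_closed)
       (metis H.S.minus_eq H.S.r_right_minus_eq)
  then show ?thesis
    by (simp add: quot_var_def quot_const_def H.hom_nat_pow[OF X])
qed

text \<open>The residue class of the indeterminate generates the quotient over the constants, put as
  an induction principle: \<open>V\<close> contains all powers of that class, hence all their linear
  combinations.\<close>

lemma quot_generated:
  assumes V: "subalgebra (quot_const R g ` carrier R) V (Rupt (carrier R) g)"
    and one: "\<one>\<^bsub>Rupt (carrier R) g\<^esub> \<in> V"
    and step: "\<And>v. v \<in> V \<Longrightarrow> quot_var R g \<otimes>\<^bsub>Rupt (carrier R) g\<^esub> v \<in> V"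
  shows "V = carrier (Rupt (carrier R) g)"
proof
  let ?E = "Rupt (carrier R) g"
  interpret P: domain "poly_ring R" by (rule poly_ring_domain)
  interpret H: ring_hom_ring "poly_ring R" ?E "rupture_surj (carrier R) g"
    by (rule quot_hom)
  interpret V: subalgebra "quot_const R g ` carrier R" V ?E by (rule V)
  show sub: "V \<subseteq> carrier ?E" using V.subset by simp
  have X: "X \<in> carrier (poly_ring R)" by (rule var_closed(1)[OF carrier_is_subring])
  note x = quot_var_closed
  have pow: "quot_var R g [^]\<^bsub>?E\<^esub> k \<in> V" for k :: nat
  proof (induction k)
    case (Suc k)
    have "quot_var R g [^]\<^bsub>?E\<^esub> Suc k = quot_var R g \<otimes>\<^bsub>?E\<^esub> quot_var R g [^]\<^bsub>?E\<^esub> k"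
      by (rule H.S.nat_pow_Suc2[OF x])
    then show ?case using step[OF Suc] by simp
  qed (use one in simp)
  \<comment> \<open>The list ranges over arbitrary coefficient lists, not only normalized
    polynomials, because the tail of a polynomial may begin with zeros. Its head is the coefficient
    of the highest power.\<close>
  have ev: "H.S.eval (map (quot_const R g) p) (quot_var R g) \<in> V" if "set p \<subseteq> carrier R" for p
    using that
  proof (induction p)
    case Nil
    then show ?case using V.one_closed by simp
  next
    case (Cons a p)
    then show ?case
      using V.m_closed[of "quot_const R g a \<otimes>\<^bsub>?E\<^esub> quot_var R g [^]\<^bsub>?E\<^esub> length p"]
        V.smult_closed[OF _ pow, of "quot_const R g a" "length p"] by simp
  qed
  show "carrier ?E \<subseteq> V"
  proof
    fix a assume "a \<in> carrier ?E"
    then obtain p where p: "p \<in> carrier (poly_ring R)" "a = rupture_surj (carrier R) g p"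
      unfolding rupture_def FactRing_def A_RCOSETS_def' by auto
    \<comment> \<open>A polynomial is its own value at the indeterminate; the projection then turns
      this into a value at the residue class.\<close>
    have "a = rupture_surj (carrier R) g (P.eval (map poly_of_const p) X)"
      using eval_rewrite[OF carrier_is_subring p(1)] p(2) by simp
    also have "\<dots> = H.S.eval (map (rupture_surj (carrier R) g) (map poly_of_const p)) (rupture_surj (carrier R) g X)"
      using H.eval_hom[OF P.carrier_is_subring X map_norm_in_poly_ring_carrier[OF carrier_is_subring p(1)]] .
    also have "\<dots> = H.S.eval (map (quot_const R g) p) (quot_var R g)"
      by (simp add: quot_const_eq quot_var_def)
    finally show "a \<in> V"
      using ev polynomial_incl[of "carrier R" p] p(1) by (simp add: univ_poly_carrier)
  qed
qed

lemma quot_dimension: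
  assumes "degree g > 0"
  shows "ring.dimension (Rupt (carrier R) g) (degree g) (quot_const R g ` carrier R)
    (carrier (Rupt (carrier R) g))"
  using rupture_dimension[OF carrier_is_subfield g assms] by (simp add: quot_const_eq image_comp)

lemma quot_const_subfield:
  assumes "field (Rupt (carrier R) g)"
  shows "inj_on (quot_const R g) (carrier R)"
    "subfield (quot_const R g ` carrier R) (Rupt (carrier R) g)"
  using ring_hom_ring.img_is_subfield[OF quot_const_hom carrier_is_subfield]
    field.axioms(1)[OF assms] domain.one_not_zero by blast+

end

section \<open>The Frobenius map on the residue class of the indeterminate, and irreducibility of
  the binomial\<close>

lemma quot_var_frobenius:
  assumes "g \<in> carrier (poly_ring R)" "c \<in> carrier R" "g pdivides binomial_poly R n c"
  shows "quot_var R g [^]\<^bsub>Rupt (carrier R) g\<^esub> Suc (n * M)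
    = quot_const R g (c [^] M) \<otimes>\<^bsub>Rupt (carrier R) g\<^esub> quot_var R g"
proof -
  interpret I: ring_hom_ring R "Rupt (carrier R) g" "quot_const R g"
    by (rule quot_const_hom[OF assms(1)])
  \<comment> \<open>Here the \<open>n\<close>-th power is the constant \<open>c\<close>, so the
    exponent \<open>n * M\<close> gives \<open>c [^] M\<close>. Over a field with
    \<open>Suc (n * M)\<close> elements the claim describes the Frobenius map.\<close>
  have "quot_var R g [^]\<^bsub>Rupt (carrier R) g\<^esub> (n * M) = quot_const R g (c [^] M)"
    by (simp add: I.S.nat_pow_pow[symmetric] quot_var_closed[OF assms(1)] quot_var_pow[OF assms] assms(2) I.hom_nat_pow)
  then show ?thesis by simp
qed

text \<open>Two values of one power are compared: a field of \<open>?N ^ ?d\<close> elements fixes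
  \<open>?x\<close>, while the twist multiplies it by \<open>?z [^] ?d\<close>. Cancelling
  \<open>?x\<close> leaves \<open>?z [^] ?d = \<one>\<close>, which \<open>ord\<close> excludes for
  \<open>0 < ?d < n\<close>.\<close>

lemma degree_irreducible_divisor_binomial_poly:
  assumes fin: "finite (carrier R)" and N: "card (carrier R) = Suc (n * M)"
    and n: "n > 0"
    and c: "c \<in> carrier R" "c \<noteq> \<zero>"
    and ord: "\<And>i. 0 < i \<Longrightarrow> i < n \<Longrightarrow> (c [^] M) [^] i \<noteq> \<one>"
    and g: "g \<in> carrier (poly_ring R)" "pirreducible (carrier R) g" "g pdivides binomial_poly R n c"
  shows "n \<le> degree g"
proof -
  let ?E = "Rupt (carrier R) g" and ?\<iota> = "quot_const R g" and ?x = "quot_var R g"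
  let ?N = "Suc (n * M)" and ?z = "c [^] M" and ?d = "degree g"
  have d: "?d > 0"
    using pirreducible_degree[OF carrier_is_subfield g(1,2)] by simp
  have E: "field ?E"
    using rupture_is_field_iff_pirreducible[OF carrier_is_subfield g(1)] g(2) by simp
  interpret E: field ?E by (rule E)
  interpret I: ring_hom_ring R ?E ?\<iota> by (rule quot_const_hom[OF g(1)])
  note inj = quot_const_subfield[OF g(1) E]
  have x: "?x \<in> carrier ?E" by (rule quot_var_closed[OF g(1)])
  have z: "?z \<in> carrier R" using c by simp
  have "finite (carrier ?E)" "card (carrier ?E) = ?N ^ ?d"
    using E.card_of_dimension[OF inj(2) _ quot_dimension[OF g(1) d]] fin card_image[OF inj(1)] N by auto
  then have "?x [^]\<^bsub>?E\<^esub> (?N ^ ?d) = ?x"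
    using E.power_card_eq_self[OF _ x] by metis
  moreover have "?x [^]\<^bsub>?E\<^esub> (?N ^ ?d) = ?\<iota> ?z [^]\<^bsub>?E\<^esub> ?d \<otimes>\<^bsub>?E\<^esub> ?x"
  proof (rule E.power_twist[OF x])
    show "?\<iota> ?z [^]\<^bsub>?E\<^esub> ?N = ?\<iota> ?z"
      using power_card_eq_self[OF fin z] N I.hom_nat_pow[OF z, of ?N] by metis
    show "?x [^]\<^bsub>?E\<^esub> ?N = ?\<iota> ?z \<otimes>\<^bsub>?E\<^esub> ?x"
      by (rule quot_var_frobenius[OF g(1) c(1) g(3)])
  qed (use z in simp)
  ultimately have e: "?\<iota> (?z [^] ?d) \<otimes>\<^bsub>?E\<^esub> ?x = \<one>\<^bsub>?E\<^esub> \<otimes>\<^bsub>?E\<^esub> ?x"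
    using x z by (simp add: I.hom_nat_pow)
  \<comment> \<open>Needed for cancellation: the \<open>n\<close>-th power of \<open>?x\<close> is
    the image of \<open>c\<close>, nonzero by injectivity.\<close>
  have "?x \<noteq> \<zero>\<^bsub>?E\<^esub>"
  proof
    assume "?x = \<zero>\<^bsub>?E\<^esub>"
    moreover have "?\<iota> c \<noteq> \<zero>\<^bsub>?E\<^esub>"
      using inj_onD[OF inj(1), of c \<zero>] c by auto
    ultimately show False
      using quot_var_pow[OF g(1) c(1) g(3)] n by (simp add: E.nat_pow_zero)
  qed
  then have "?\<iota> (?z [^] ?d) = \<one>\<^bsub>?E\<^esub>"
    using e x z E.m_rcancel[of ?x "?\<iota> (?z [^] ?d)" "\<one>\<^bsub>?E\<^esub>"] by simp
  then have "?z [^] ?d = \<one>"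
    using inj_onD[OF inj(1), of "?z [^] ?d" \<one>] z by simp
  then show ?thesis using ord[OF d] by force
qed

text \<open>By the degree bound a non-unit factor already has the full degree \<open>n\<close>, so
  its cofactor is a nonzero constant.\<close>

lemma pirreducible_binomial_poly:
  assumes fin: "finite (carrier R)" and N: "card (carrier R) = Suc (n * M)" and n: "n > 0"
    and c: "c \<in> carrier R" "c \<noteq> \<zero>"
    and ord: "\<And>i. 0 < i \<Longrightarrow> i < n \<Longrightarrow> (c [^] M) [^] i \<noteq> \<one>"
  shows "pirreducible (carrier R) (binomial_poly R n c)" (is "pirreducible _ ?f")
proof -
  interpret P: principal_domain "poly_ring R"
    by (rule univ_poly_is_principal[OF carrier_is_subfield])
  have f: "?f \<in> carrier (poly_ring R)" by (rule binomial_poly_closed[OF c(1)])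
  have deg: "degree ?f = n"
    by (rule degree_binomial_poly[OF c(1) n])
  show ?thesis
  proof (rule pirreducibleI[OF carrier_is_subring f])
    show ne: "?f \<noteq> []" using deg n by auto
    show "?f \<notin> Units (poly_ring R)" using univ_poly_units'[OF carrier_is_subfield, of ?f] deg n by linarith
    fix q r assume q: "q \<in> carrier (poly_ring R)" and r: "r \<in> carrier (poly_ring R)"
      and fqr: "?f = q \<otimes>\<^bsub>poly_ring R\<^esub> r"
    have ne': "q \<noteq> []" "r \<noteq> []"
      using fqr ne P.l_null[OF r] P.r_null[OF q] unfolding univ_poly_zero by metis+
    have "n = degree q + degree r"
      using poly_mult_degree_eq[OF carrier_is_subring, of q r] q r ne' deg
      unfolding fqr by (simp add: univ_poly_mult univ_poly_carrier del: poly_mult.simps)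
    show "q \<in> Units (poly_ring R) \<or> r \<in> Units (poly_ring R)"
    proof (cases "q \<in> Units (poly_ring R)")
      case False
      then obtain g where g: "g \<in> carrier (poly_ring R)" "pirreducible (carrier R) g" "g divides\<^bsub>poly_ring R\<^esub> q"
        using P.exists_irreducible_divisor[of q] q ne'(1) unfolding univ_poly_zero by blast
      have "g divides\<^bsub>poly_ring R\<^esub> ?f"
        unfolding fqr using P.divides_prod_r[OF g(3,1) r] .
      then have "n \<le> degree g"
        using degree_irreducible_divisor_binomial_poly[OF fin N n c ord g(1,2)] by (simp add: pdivides_def)
      also have "\<dots> \<le> degree q"
        using pdivides_imp_degree_le[OF carrier_is_subring g(1) q ne'(1)] g(3) by (simp add: pdivides_def)
      finally have "degree r = 0" using \<open>n = _\<close> by simp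
      then show ?thesis using univ_poly_units'[OF carrier_is_subfield, of r] r ne' by simp
    qed simp
  qed
qed

end

section \<open>Extensions on which the Frobenius map scales a generator\<close>

text \<open>Isolates what the argument uses of the quotient: the \<open>N\<close>-th power map fixes
  \<open>K\<close>, respects differences and scales \<alpha> by \<zeta>. The condition on
  \<open>add_pow R n \<one>\<close> keeps the trace of \<gamma> nonzero, and
  \<open>generated\<close> says that \<alpha> generates the field over \<open>K\<close>.\<close>

locale cyclic_twist = field R for R (structure) +
  fixes K :: "'a set" and N n :: nat and \<alpha> \<zeta> b :: 'a
  assumes K: "subfield K R"
    and \<alpha>: "\<alpha> \<in> carrier R" and \<zeta>: "\<zeta> \<in> K" and b: "b \<in> K" "b \<noteq> \<zero>"
    and frob_fix: "\<And>a. a \<in> K \<Longrightarrow> a [^] N = a"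
    and frob_minus: "\<And>x y k. x \<in> carrier R \<Longrightarrow> y \<in> carrier R \<Longrightarrow>
          (x \<ominus> y) [^] (N ^ k) = x [^] (N ^ k) \<ominus> y [^] (N ^ k)"
    and frob_\<alpha>: "\<alpha> [^] N = \<zeta> \<otimes> \<alpha>"
    and \<alpha>_pow: "\<alpha> [^] n \<in> K" "\<alpha> [^] n \<noteq> b [^] n"
    and \<zeta>_pow: "\<zeta> [^] n = \<one>" "\<And>i. 0 < i \<Longrightarrow> i < n \<Longrightarrow> \<zeta> [^] i \<noteq> \<one>"
    and n: "n > 0" "add_pow R n \<one> \<noteq> \<zero>"
    and generated: "\<And>V. subalgebra K V R \<Longrightarrow> \<one> \<in> V \<Longrightarrow> (\<And>v. v \<in> V \<Longrightarrow> \<alpha> \<otimes> v \<in> V) \<Longrightarrow> V = carrier R"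
    and dim: "dimension n K (carrier R)"
begin

definition "\<gamma> = inv (\<alpha> \<ominus> b)"

text \<open>The \<open>i\<close>-th conjugate of \<alpha>, equal to
  \<open>\<alpha> [^] (N ^ i)\<close> by \<open>power_twist\<close>.\<close>

definition "\<beta> i = \<zeta> [^] (i::nat) \<otimes> \<alpha>"

section \<open>The conjugates of \<alpha> and \<gamma>, and the product relation between
  them\<close>

lemma K_carrier: "x \<in> K \<Longrightarrow> x \<in> carrier R"
  using subfieldE(3)[OF K] by blast

lemmas base_closed [simp] = \<alpha> K_carrier[OF \<zeta>] K_carrier[OF b(1)]

lemma pow_K: "x \<in> K \<Longrightarrow> x [^] (k::nat) \<in> K"
  by (induction k) (use subringE(3,6)[OF subfieldE(1)[OF K]] in auto)

lemma \<beta>_closed [simp]: "\<beta> i \<in> carrier R"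
  by (simp add: \<beta>_def)

lemma \<beta>_pow: "\<beta> i [^] n = \<alpha> [^] n"
proof -
  have "(\<zeta> [^] i) [^] n = (\<zeta> [^] n) [^] i"
    unfolding nat_pow_pow[OF base_closed(2)] by (simp add: mult.commute)
  then show ?thesis by (simp add: \<beta>_def nat_pow_distrib \<zeta>_pow)
qed

text \<open>All conjugates of \<alpha> share its \<open>n\<close>-th power, so
  \<open>\<beta> i = b\<close> would give \<open>\<alpha> [^] n = b [^] n\<close>.\<close>

lemma \<beta>_ne: "\<beta> i \<ominus> b \<noteq> \<zero>"
  using \<alpha>_pow(2) \<beta>_pow[of i] by auto

lemma minus_unit: "\<beta> i \<ominus> b \<in> Units R"
  using \<beta>_ne by (simp add: field_Units)

lemma frob_pow_fix: "a \<in> K \<Longrightarrow> a [^] (N ^ i) = a"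
  by (induction i) (auto simp: K_carrier frob_fix nat_pow_pow[symmetric])

text \<open>Powers commute with inversion, and the \<open>N ^ i\<close>-th power fixes
  \<open>b\<close> and sends \<alpha> to \<open>\<beta> i\<close>.\<close>

lemma \<gamma>_pow: "\<gamma> [^] (N ^ i) = inv (\<beta> i \<ominus> b)"
proof -
  have "\<alpha> \<ominus> b \<in> Units R" using minus_unit[of 0] by (simp add: \<beta>_def)
  then have "\<gamma> [^] (N ^ i) = inv ((\<alpha> \<ominus> b) [^] (N ^ i))"
    unfolding \<gamma>_def by (rule inv_nat_pow)
  also have "(\<alpha> \<ominus> b) [^] (N ^ i) = \<beta> i \<ominus> b"
    using power_twist[OF \<alpha> _ frob_fix[OF \<zeta>] frob_\<alpha>, of i]
    by (simp add: frob_minus frob_pow_fix b \<beta>_def)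
  finally show ?thesis .
qed

lemma \<gamma>_closed [simp]: "\<gamma> [^] (N ^ i) \<in> carrier R"
  unfolding \<gamma>_pow using minus_unit by simp

lemma \<gamma>_in_carrier [simp]: "\<gamma> \<in> carrier R"
  using \<gamma>_closed[of 0] minus_unit[of 0] by (simp add: \<gamma>_def \<beta>_def)

lemma \<gamma>_mult: "(\<beta> i \<ominus> b) \<otimes> \<gamma> [^] (N ^ i) = \<one>"
  unfolding \<gamma>_pow using minus_unit by simp

lemma relation:
  "(\<zeta> [^] i \<ominus> \<one>) \<otimes> b \<otimes> \<gamma> [^] (1 + N ^ i) = \<gamma> \<ominus> \<zeta> [^] i \<otimes> \<gamma> [^] (N ^ i)"
proof -
  let ?z = "\<zeta> [^] i" and ?g = "\<gamma> [^] (N ^ i)"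
  have 1: "(?z \<otimes> \<alpha> \<ominus> b) \<otimes> ?g = \<one>" using \<gamma>_mult[of i] by (simp add: \<beta>_def)
  have 2: "(\<alpha> \<ominus> b) \<otimes> \<gamma> = \<one>" using \<gamma>_mult[of 0] by (simp add: \<beta>_def)
  have z: "?z \<in> carrier R" by simp
  have c: "\<gamma> \<in> carrier R" "?g \<in> carrier R" "b \<in> carrier R" "\<alpha> \<in> carrier R" by simp_all
  have "\<gamma> [^] (1 + N ^ i) = \<gamma> \<otimes> ?g" using nat_pow_mult[of \<gamma> 1 "N ^ i"] by simp
  \<comment> \<open>Each term on the right carries an inserted factor equal to one. Over the common
    factor \<open>\<gamma> \<otimes> ?g\<close> the multiples of \<alpha> cancel and
    \<open>(?z \<ominus> \<one>) \<otimes> b\<close> remains.\<close>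
  then have "(?z \<ominus> \<one>) \<otimes> b \<otimes> \<gamma> [^] (1 + N ^ i)
      = \<gamma> \<otimes> ((?z \<otimes> \<alpha> \<ominus> b) \<otimes> ?g) \<ominus> ?z \<otimes> (((\<alpha> \<ominus> b) \<otimes> \<gamma>) \<otimes> ?g)"
    using z c by algebra
  then show ?thesis unfolding 1 2 using z c by simp
qed

section \<open>Sums of powers of \<zeta> and the trace of \<gamma>\<close>

lemma sum_\<zeta>:
  assumes "k < n"
  shows "(\<Oplus>i\<in>{..n - 1}. (\<zeta> [^] i) [^] k) = (if k = 0 then add_pow R n \<one> else \<zero>)"
proof (cases "k = 0")
  case True
  \<comment> \<open>The range \<open>{..m}\<close> has \<open>Suc m\<close> members; since
    \<open>n > 0\<close>, the range \<open>{..n - 1}\<close> has exactly \<open>n\<close>.\<close>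
  have "(\<Oplus>i\<in>{..m}. \<one>) = add_pow R (Suc m) \<one>" for m :: nat
    by (induction m) (auto simp: a_comm)
  from this[of "n - 1"] True n show ?thesis by simp
next
  case False
  let ?S = "\<Oplus>i\<in>{..n - 1}. (\<zeta> [^] k) [^] i"
  \<comment> \<open>The geometric sum times \<open>\<zeta> [^] k \<ominus> \<one>\<close> is
    \<open>(\<zeta> [^] n) [^] k \<ominus> \<one> = \<zero>\<close>, and this factor is nonzero
    because \<open>0 < k < n\<close>.\<close>
  have "(\<zeta> [^] k \<ominus> \<one>) \<otimes> (\<Oplus>i\<in>{..n - 1}. (\<zeta> [^] k) [^] i \<otimes> \<one> [^] (n - 1 - i))
      = (\<zeta> [^] k) [^] Suc (n - 1) \<ominus> \<one> [^] Suc (n - 1)"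
    by (rule power_sub_eq_geometric) auto
  also have "(\<zeta> [^] k) [^] Suc (n - 1) = (\<zeta> [^] n) [^] k"
    using n by (simp add: nat_pow_pow mult.commute del: nat_pow_Suc)
  finally have "(\<zeta> [^] k \<ominus> \<one>) \<otimes> ?S = \<zero>"
    by (simp add: \<zeta>_pow del: nat_pow_Suc)
  moreover have "\<zeta> [^] k \<ominus> \<one> \<noteq> \<zero>"
    using \<zeta>_pow(2)[of k] False assms by auto
  moreover have "?S \<in> carrier R" by (auto intro!: finsum_closed)
  ultimately have "?S = \<zero>" using integral[of "\<zeta> [^] k \<ominus> \<one>" ?S] by auto
  moreover have "(\<Oplus>i\<in>{..n - 1}. (\<zeta> [^] i) [^] k) = ?S"
    by (intro finsum_cong') (auto simp: nat_pow_pow mult.commute)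
  ultimately show ?thesis using False by simp
qed

text \<open>As \<open>\<beta> i\<close> and \<alpha> have the same \<open>n\<close>-th power, the
  factor on the left is independent of \<open>i\<close> and can be taken out of a sum over the
  conjugates.\<close>

lemma \<gamma>_expand:
  "(\<alpha> [^] n \<ominus> b [^] n) \<otimes> \<gamma> [^] (N ^ i) = (\<Oplus>k\<in>{..n - 1}. \<beta> i [^] k \<otimes> b [^] (n - 1 - k))"
    (is "_ = ?G")
proof -
  have G: "?G \<in> carrier R" by (auto intro!: finsum_closed)
  have "(\<beta> i \<ominus> b) \<otimes> ?G = \<alpha> [^] n \<ominus> b [^] n"
    using power_sub_eq_geometric[of "\<beta> i" b "n - 1"] n \<beta>_pow[of i] by (simp del: nat_pow_Suc)
  then have "(\<alpha> [^] n \<ominus> b [^] n) \<otimes> \<gamma> [^] (N ^ i) = ((\<beta> i \<ominus> b) \<otimes> ?G) \<otimes> \<gamma> [^] (N ^ i)"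
    by simp
  also have "\<dots> = ((\<beta> i \<ominus> b) \<otimes> \<gamma> [^] (N ^ i)) \<otimes> ?G"
    by (rule m_rcomm) (use G in simp_all)
  finally have "(\<alpha> [^] n \<ominus> b [^] n) \<otimes> \<gamma> [^] (N ^ i) = ((\<beta> i \<ominus> b) \<otimes> \<gamma> [^] (N ^ i)) \<otimes> ?G" .
  then show ?thesis using G by (simp add: \<gamma>_mult)
qed

text \<open>Stated without an inverse, since the span argument needs only that a scalar multiple of
  the trace is a nonzero element of \<open>K\<close>.\<close>

lemma trace_mult:
  "(\<alpha> [^] n \<ominus> b [^] n) \<otimes> (\<Oplus>i\<in>{..n - 1}. \<gamma> [^] (N ^ i)) = add_pow R n (b [^] (n - 1))"
proof -
  let ?f = "\<lambda>i k. \<beta> i [^] k \<otimes> b [^] (n - 1 - k)"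
  have "(\<alpha> [^] n \<ominus> b [^] n) \<otimes> (\<Oplus>i\<in>{..n - 1}. \<gamma> [^] (N ^ i))
      = (\<Oplus>i\<in>{..n - 1}. (\<alpha> [^] n \<ominus> b [^] n) \<otimes> \<gamma> [^] (N ^ i))"
    by (rule finsum_rdistr) auto
  also have "\<dots> = (\<Oplus>i\<in>{..n - 1}. \<Oplus>k\<in>{..n - 1}. ?f i k)"
    by (rule finsum_cong') (auto simp: \<gamma>_expand intro!: finsum_closed)
  also have "\<dots> = (\<Oplus>k\<in>{..n - 1}. \<Oplus>i\<in>{..n - 1}. ?f i k)"
    by (rule finsum_swap_atMost) auto
  \<comment> \<open>After the exchange, the inner sum is the sum of the
    \<open>(\<zeta> [^] i) [^] k\<close> times a factor free of \<open>i\<close>; by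
    \<open>sum_\<zeta>\<close> only \<open>k = 0\<close> survives.\<close>
  also have "\<dots> = (\<Oplus>k\<in>{..n - 1}. if k = 0 then add_pow R n (b [^] (n - 1)) else \<zero>)"
  proof (rule finsum_cong')
    fix k assume k: "k \<in> {..n - 1}"
    have "(\<Oplus>i\<in>{..n - 1}. ?f i k) = (\<Oplus>i\<in>{..n - 1}. (\<zeta> [^] i) [^] k \<otimes> (\<alpha> [^] k \<otimes> b [^] (n - 1 - k)))"
      by (rule finsum_cong') (auto simp: \<beta>_def nat_pow_distrib m_assoc)
    also have "\<dots> = (\<Oplus>i\<in>{..n - 1}. (\<zeta> [^] i) [^] k) \<otimes> (\<alpha> [^] k \<otimes> b [^] (n - 1 - k))"
      by (rule finsum_ldistr[symmetric]) auto
    also have "\<dots> = (if k = 0 then add_pow R n (b [^] (n - 1)) else \<zero>)"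
    proof -
      have "k < n" using k n by auto
      then show ?thesis unfolding sum_\<zeta>[OF \<open>k < n\<close>] by (simp add: add_pow_ldistr)
    qed
    finally show "(\<Oplus>i\<in>{..n - 1}. ?f i k) = (if k = 0 then add_pow R n (b [^] (n - 1)) else \<zero>)" .
  qed auto
  also have "\<dots> = add_pow R n (b [^] (n - 1))"
    using finsum_singleton[of 0 "{..n - 1}" "\<lambda>_. add_pow R n (b [^] (n - 1))"] by (simp add: eq_commute)
  finally show ?thesis .
qed

lemma pow_diff_unit: "b [^] n \<ominus> \<alpha> [^] n \<in> Units R"
  using \<alpha>_pow(2) by (auto simp: field_Units)

text \<open>The factor in \<open>trace_mult\<close> is the negative of
  \<open>b [^] n \<ominus> \<alpha> [^] n\<close>, which accounts for the sign.\<close>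

lemma trace:
  "(\<Oplus>i\<in>{..n - 1}. \<gamma> [^] (N ^ i)) = \<ominus> add_pow R n (b [^] (n - 1) \<otimes> inv (b [^] n \<ominus> \<alpha> [^] n))"
    (is "?T = _")
proof -
  let ?u = "b [^] n \<ominus> \<alpha> [^] n" and ?c = "add_pow R n (b [^] (n - 1))"
  have T: "?T \<in> carrier R" by (auto intro!: finsum_closed)
  have u: "?u \<in> carrier R" "inv ?u \<in> carrier R" "?u \<otimes> inv ?u = \<one>"
    using pow_diff_unit by auto
  have c: "?c \<in> carrier R" by simp
  have "\<alpha> [^] n \<ominus> b [^] n = \<ominus> ?u"
    by (simp add: minus_eq minus_add a_comm)
  then have "\<ominus> (?u \<otimes> ?T) = ?c" using trace_mult T u by (simp add: l_minus)
  then have e: "?u \<otimes> ?T = \<ominus> ?c" using T u by (metis m_closed minus_minus)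
  have "?T = (?u \<otimes> inv ?u) \<otimes> ?T" using T u by simp
  also have "\<dots> = (?u \<otimes> ?T) \<otimes> inv ?u" by (rule m_rcomm[OF u(1,2) T])
  also have "\<dots> = \<ominus> (?c \<otimes> inv ?u)" unfolding e using u c by (simp add: l_minus)
  also have "\<dots> = \<ominus> add_pow R n (b [^] (n - 1) \<otimes> inv ?u)"
    using u(2) by (simp add: add_pow_ldistr)
  finally show ?thesis .
qed

section \<open>The conjugates of \<gamma> span the extension and form a basis\<close>

lemma span: "Span K (map (\<lambda>i. \<gamma> [^] (N ^ i)) [0..<n]) = carrier R" (is "?S = _")
proof (rule generated)
  let ?vs = "map (\<lambda>i. \<gamma> [^] (N ^ i)) [0..<n]"
  have vs: "set ?vs \<subseteq> carrier R" by auto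
  show sub: "subalgebra K ?S R"
    by (rule Span_is_subalgebra[OF K vs])
  have mem: "\<gamma> [^] (N ^ i) \<in> ?S" if "i < n" for i
    using Span_base_incl[OF K vs] that by auto
  note S = Span_subgroup_props[OF K vs]
  show one: "\<one> \<in> ?S"
  \<comment> \<open>It suffices to find a nonzero scalar multiple of \<open>\<one>\<close> in the
    span; the scalar is \<open>n\<close> times \<open>b [^] (n - 1)\<close>, supplied by the
    trace.\<close>
  proof (rule Span_m_inv_simprule[OF K vs])
    have "(\<Oplus>i\<in>{..n - 1}. \<gamma> [^] (N ^ i)) \<in> ?S"
      using n by (intro finsum_in_Span[OF K vs] mem) auto
    moreover have "\<alpha> [^] n \<ominus> b [^] n \<in> K"
      using \<alpha>_pow pow_K b subringE(5,7)[OF subfieldE(1)[OF K]] by (simp add: minus_eq)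
    ultimately have "add_pow R n (b [^] (n - 1)) \<in> ?S"
      unfolding trace_mult[symmetric] by (intro Span_smult_closed[OF K vs])
    then show "add_pow R n (b [^] (n - 1)) \<otimes> \<one> \<in> ?S" by simp
    have "add_pow R m x \<in> K" if "x \<in> K" for x and m :: nat
      using that by (induction m) (use subringE(2,7)[OF subfieldE(1)[OF K]] in auto)
    moreover have "add_pow R n (b [^] (n - 1)) \<noteq> \<zero>"
    proof -
      have "add_pow R n (b [^] (n - 1)) = add_pow R n \<one> \<otimes> b [^] (n - 1)"
        by (simp add: add_pow_ldistr)
      moreover have "b [^] (n - 1) \<noteq> \<zero>"
        using b by (intro nat_pow_nonzero) auto
      ultimately show ?thesis using n by (simp add: integral_iff)
    qed
    ultimately show "add_pow R n (b [^] (n - 1)) \<in> K - {\<zero>}"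
      using pow_K[OF b(1)] by auto
  qed simp
  \<comment> \<open>The multiple by \<open>\<zeta> [^] i\<close> is \<open>\<one>\<close> plus
    \<open>b\<close> times the conjugate, which lies in the span; the nonzero scalar
    \<open>\<zeta> [^] i\<close> is then divided out.\<close>
  have step: "\<alpha> \<otimes> \<gamma> [^] (N ^ i) \<in> ?S" if "i < n" for i
  proof (rule Span_m_inv_simprule[OF K vs])
    let ?g = "\<gamma> [^] (N ^ i)" and ?z = "\<zeta> [^] i"
    have z: "?z \<in> carrier R" "?g \<in> carrier R" "b \<in> carrier R" by simp_all
    have "?z \<otimes> (\<alpha> \<otimes> ?g) = (\<beta> i \<ominus> b) \<otimes> ?g \<oplus> b \<otimes> ?g"
      unfolding \<beta>_def using z \<alpha> by algebra
    then show "?z \<otimes> (\<alpha> \<otimes> ?g) \<in> ?S"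
      unfolding \<gamma>_mult using S(3)[OF one] Span_smult_closed[OF K vs b(1) mem[OF that]] by simp
    have "\<zeta> \<noteq> \<zero>"
      using \<zeta>_pow(1) n by (metis one_not_zero nat_pow_zero neq0_conv)
    then have "?z \<noteq> \<zero>" by (intro nat_pow_nonzero) auto
    then show "?z \<in> K - {\<zero>}" using pow_K[OF \<zeta>] by simp
  qed simp
  \<comment> \<open>The vectors that \<alpha> multiplies into the span form a subspace; it contains
    the conjugates, hence the whole span.\<close>
  let ?V = "{v \<in> carrier R. \<alpha> \<otimes> v \<in> ?S}"
  have "subalgebra K ?V R"
  proof
    show "?V \<subseteq> carrier (add_monoid R)" by auto
    show "x \<otimes>\<^bsub>add_monoid R\<^esub> y \<in> ?V" if "x \<in> ?V" "y \<in> ?V" for x y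
      using that S(3) by (auto simp: r_distr)
    show "\<one>\<^bsub>add_monoid R\<^esub> \<in> ?V" using S(2) by simp
    show "inv\<^bsub>add_monoid R\<^esub> x \<in> ?V" if "x \<in> ?V" for x
      using that S(4) by (auto simp: r_minus a_inv_def[symmetric])
    show "k \<otimes> v \<in> ?V" if "k \<in> K" "v \<in> ?V" for k v
      using that Span_smult_closed[OF K vs, of k "\<alpha> \<otimes> v"] by (auto simp: K_carrier m_lcomm)
  qed
  moreover have "set ?vs \<subseteq> ?V" using step by auto
  ultimately have "?S \<subseteq> ?V" by (rule subalgebra_Span_incl[OF K])
  then show "\<alpha> \<otimes> v \<in> ?S" if "v \<in> ?S" for v using that by blast
qed

lemma basis: "is_basis R K (map (\<lambda>i. \<gamma> [^] (N ^ i)) [0..<n])"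
  by (rule is_basis_if_Span_dimension[OF K dim _ _ span]) auto

end

section \<open>Characteristic and roots of unity\<close>

text \<open>Cancelling \<open>q ^ (r - s)\<close> leaves \<open>q ^ s dvd m * i\<close>, and
  \<open>m\<close> is coprime to \<open>q\<close>. This bounds the order of \<zeta> from
  below.\<close>

lemma prime_power_dvd_cofactor:
  fixes q m r s i :: nat
  assumes q: "q > 0" and "gcd m q = 1" "s \<le> r" "q ^ r dvd m * q ^ (r - s) * i"
  shows "q ^ s dvd i"
proof -
  have "q ^ r = q ^ s * q ^ (r - s)"
    using assms(3) by (simp flip: power_add)
  then have "q ^ (r - s) * q ^ s dvd q ^ (r - s) * (m * i)"
    using assms(4) by (simp add: ac_simps)
  then have "q ^ s dvd m * i" using q by simp
  moreover have "coprime (q ^ s) m"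
    using assms(2) by (metis coprime_iff_gcd_eq_1 coprime_commute coprime_power_left_iff)
  ultimately show ?thesis by (simp add: coprime_dvd_mult_right_iff)
qed

lemma (in ring) primitive_root_of_unity_dvd:
  assumes "primitive_root_of_unity R n x" "x [^] (k::nat) = \<one>"
  shows "n dvd k"
proof (rule ccontr)
  assume "\<not> n dvd k"
  have x: "x \<in> carrier R" "x [^] n = \<one>" "n > 0"
    and min: "\<And>j::nat. 0 < j \<Longrightarrow> j < n \<Longrightarrow> x [^] j \<noteq> \<one>"
    using assms(1) by (auto simp: primitive_root_of_unity_def)
  have "x [^] k = x [^] (n * (k div n)) \<otimes> x [^] (k mod n)"
    using nat_pow_mult[OF x(1), of "n * (k div n)" "k mod n"] by simp
  also have "x [^] (n * (k div n)) = \<one>"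
    using nat_pow_pow[OF x(1), of n "k div n"] x by simp
  finally have "x [^] (k mod n) = \<one>" using assms(2) x by simp
  then show False using min[of "k mod n"] \<open>\<not> n dvd k\<close> x(3) by (simp add: mod_greater_zero_iff_not_dvd)
qed

text \<open>Lagrange's theorem in the additive group makes \<open>p ^ l\<close> times
  \<open>\<one>\<close> zero. That element is the \<open>l\<close>-th power of \<open>p\<close>
  times \<open>\<one>\<close>, and a field has no nonzero nilpotents.\<close>

lemma (in field) char_of_prime_power_card:
  fixes p :: nat
  assumes "finite (carrier R)" "card (carrier R) = p ^ l"
  shows "add_pow R p \<one> = \<zero>"
proof -
  have "add_pow R (p ^ l) \<one> = \<zero>"
    using add.pow_order_eq_1[of \<one>] assms(2) by (simp add: order_def)
  moreover have "add_pow R (p ^ k) \<one> = (add_pow R p \<one>) [^] k" for k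
  proof (induction k)
    case (Suc k)
    have "add_pow R (p ^ Suc k) \<one> = add_pow R p (add_pow R (p ^ k) \<one>)"
      by (simp add: add.nat_pow_pow mult.commute)
    also have "\<dots> = add_pow R p (add_pow R (p ^ k) \<one> \<otimes> \<one>)" by simp
    also have "\<dots> = add_pow R (p ^ k) \<one> \<otimes> add_pow R p \<one>"
      by (rule add_pow_rdistr[symmetric]) auto
    finally show ?case using Suc by simp
  qed (simp add: add.nat_pow_eone)
  ultimately show ?thesis using nat_pow_nonzero[of "add_pow R p \<one>" l] by auto
qed

lemma (in ring) add_pow_coprime_nonzero:
  fixes p n :: nat
  assumes "\<one> \<noteq> \<zero>" "add_pow R p \<one> = \<zero>" "coprime p n"
  shows "add_pow R n \<one> \<noteq> \<zero>"
proof
  assume n: "add_pow R n \<one> = \<zero>"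
  show False
  proof (cases "p = 0")
    case True
    then show ?thesis using assms n by simp
  next
    case False
    \<comment> \<open>Bezout's identity in the natural numbers needs a nonzero first argument; for
      \<open>p = 0\<close> coprimality forces \<open>n = 1\<close>, treated above.\<close>
    obtain x y where xy: "p * x = n * y + gcd p n"
      using bezout_nat[OF False] by blast
    have "add_pow R (p * x) \<one> = \<zero>" "add_pow R (n * y) \<one> = \<zero>"
      using assms(2) n by (simp_all add: add.nat_pow_pow[symmetric])
    moreover have "add_pow R (n * y + 1) \<one> = add_pow R (n * y) \<one> \<oplus> \<one>"
      by simp
    ultimately show False using xy assms(1,3) by (simp add: coprime_iff_gcd_eq_1)
  qed
qed

lemma (in ring_hom_ring) hom_add_pow:
  "x \<in> carrier R \<Longrightarrow> h (add_pow R (k::nat) x) = add_pow S k (h x)"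
  by (induction k) auto

section \<open>Normality\<close>

theorem mainTheorem6:
  fixes F :: "('a, 'b) ring_scheme"
    and E :: "'a list set ring"
    and \<iota> :: "'a \<Rightarrow> 'a list set"
    and p q l r m s :: nat
    and \<xi> \<zeta> b :: 'a
    and f :: "'a list"
    and \<alpha> \<gamma> :: "'a list set"
  assumes "Factorial_Ring.prime p" and "Factorial_Ring.prime q" and "p \<noteq> q"
    and "l > 0" and "q dvd p ^ l - 1"
    and "r > 0" and "q ^ r dvd p ^ l - 1"
    and "\<forall>k. q ^ k dvd p ^ l - 1 \<longrightarrow> k \<le> r"
    and "p ^ l - 1 = m * q ^ r" and "gcd m q = 1"
    and "field F" and "finite (carrier F)" and "card (carrier F) = p ^ l"
    and "primitive_root_of_unity F (q ^ r) \<xi>"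
    and "s > 0" and "s \<le> r"
    and f_def: "f = binomial_poly F (q ^ s) \<xi>"
    and E_def: "E = Rupt\<^bsub>F\<^esub> (carrier F) f"
    and \<iota>_def: "\<iota> = quot_const F f"
    and \<alpha>_def: "\<alpha> = quot_var F f"
    and \<zeta>_def: "\<zeta> = \<xi> [^]\<^bsub>F\<^esub> (m * q ^ (r - s))"
    and "b \<in> carrier F - {\<zero>\<^bsub>F\<^esub>}" and "b [^]\<^bsub>F\<^esub> (q ^ s) \<noteq> \<xi>"
    and \<gamma>_def: "\<gamma> = inv\<^bsub>E\<^esub> (\<alpha> \<ominus>\<^bsub>E\<^esub> \<iota> b)"
  shows "pirreducible\<^bsub>F\<^esub> (carrier F) f \<and>
    normal_element E (\<iota> ` carrier F) \<gamma> \<and>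
    is_basis E (\<iota> ` carrier F) (map (\<lambda>i. \<gamma> [^]\<^bsub>E\<^esub> (p ^ (i * l))) [0..<q ^ s]) \<and>
    (\<forall>i\<in>{1..q ^ s - 1}.
      \<zeta> [^]\<^bsub>F\<^esub> i \<noteq> \<one>\<^bsub>F\<^esub> \<and>
      \<iota> (\<zeta> [^]\<^bsub>F\<^esub> i \<ominus>\<^bsub>F\<^esub> \<one>\<^bsub>F\<^esub>) \<otimes>\<^bsub>E\<^esub> \<iota> b \<otimes>\<^bsub>E\<^esub> \<gamma> [^]\<^bsub>E\<^esub> (1 + p ^ (i * l)) =
        \<gamma> \<ominus>\<^bsub>E\<^esub> \<iota> (\<zeta> [^]\<^bsub>F\<^esub> i) \<otimes>\<^bsub>E\<^esub> \<gamma> [^]\<^bsub>E\<^esub> (p ^ (i * l))) \<and>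
    (\<Oplus>\<^bsub>E\<^esub>i\<in>{0..q ^ s - 1}. \<gamma> [^]\<^bsub>E\<^esub> (p ^ (i * l))) =
      \<iota> (\<ominus>\<^bsub>F\<^esub> ([(q ^ s)] \<cdot>\<^bsub>F\<^esub> (b [^]\<^bsub>F\<^esub> (q ^ s - 1)
             \<otimes>\<^bsub>F\<^esub> inv\<^bsub>F\<^esub> (b [^]\<^bsub>F\<^esub> (q ^ s) \<ominus>\<^bsub>F\<^esub> \<xi>))))"
proof -
  define n where "n = q ^ s"
  \<comment> \<open>Chosen so that \<open>p ^ l = Suc (n * M)\<close> and
    \<open>\<zeta> = \<xi> [^] M\<close>, the form in which the Frobenius map scales
    \<alpha>.\<close>
  define M where "M = m * q ^ (r - s)"
  interpret F: field F by fact
  have q: "q > 0" using \<open>Factorial_Ring.prime q\<close> by (rule prime_gt_0_nat)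
  have n: "n > 0" using q by (simp add: n_def)
  have \<xi>: "\<xi> \<in> carrier F" "\<xi> [^]\<^bsub>F\<^esub> (q ^ r) = \<one>\<^bsub>F\<^esub>"
    using \<open>primitive_root_of_unity F (q ^ r) \<xi>\<close> by (auto simp: primitive_root_of_unity_def)
  have "\<xi> \<noteq> \<zero>\<^bsub>F\<^esub>"
    using \<xi>(2) q F.nat_pow_zero[of "q ^ r"] by auto
  have "n * M = m * q ^ r"
    using \<open>s \<le> r\<close> by (simp add: n_def M_def flip: power_add)
  moreover have "p ^ l > 0" using prime_gt_0_nat[OF \<open>Factorial_Ring.prime p\<close>] by simp
  ultimately have N: "p ^ l = Suc (n * M)" using \<open>p ^ l - 1 = m * q ^ r\<close> by linarith
  have \<zeta>_eq: "\<zeta> = \<xi> [^]\<^bsub>F\<^esub> M" by (simp add: \<zeta>_def M_def)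
  have \<zeta>: "\<zeta> \<in> carrier F" using \<xi> by (simp add: \<zeta>_eq)
  have \<zeta>_ne: "\<zeta> [^]\<^bsub>F\<^esub> i \<noteq> \<one>\<^bsub>F\<^esub>" if "0 < i" "i < n" for i :: nat
  proof
    assume "\<zeta> [^]\<^bsub>F\<^esub> i = \<one>\<^bsub>F\<^esub>"
    then have "\<xi> [^]\<^bsub>F\<^esub> (M * i) = \<one>\<^bsub>F\<^esub>" using \<xi> by (simp add: \<zeta>_eq F.nat_pow_pow)
    then have "q ^ r dvd M * i"
      by (rule F.primitive_root_of_unity_dvd[OF \<open>primitive_root_of_unity F (q ^ r) \<xi>\<close>])
    then have "n dvd i"
      using prime_power_dvd_cofactor[OF q \<open>gcd m q = 1\<close> \<open>s \<le> r\<close>] by (simp add: n_def M_def)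
    then show False using that by (auto dest: dvd_imp_le)
  qed
  have \<zeta>_n: "\<zeta> [^]\<^bsub>F\<^esub> n = \<one>\<^bsub>F\<^esub>"
  proof -
    have "\<zeta> [^]\<^bsub>F\<^esub> n = (\<xi> [^]\<^bsub>F\<^esub> (q ^ r)) [^]\<^bsub>F\<^esub> m"
      using \<open>n * M = _\<close> \<xi>(1) by (simp add: \<zeta>_eq F.nat_pow_pow mult.commute)
    then show ?thesis using \<xi>(2) by simp
  qed
  have f: "f \<in> carrier (poly_ring F)" "degree f = n" "f = binomial_poly F n \<xi>"
    using F.binomial_poly_closed[OF \<xi>(1)] F.degree_binomial_poly[OF \<xi>(1) n] by (simp_all add: f_def n_def)
  have irr: "pirreducible\<^bsub>F\<^esub> (carrier F) f"
    unfolding f(3)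
    using \<open>finite (carrier F)\<close> \<open>card (carrier F) = p ^ l\<close> N n \<xi>(1) \<open>\<xi> \<noteq> \<zero>\<^bsub>F\<^esub>\<close> \<zeta>_ne
    by (intro F.pirreducible_binomial_poly[where M = M]) (auto simp: \<zeta>_eq)
  interpret E: field E
    unfolding E_def using F.rupture_is_field_iff_pirreducible[OF F.carrier_is_subfield f(1)] irr by simp
  interpret I: ring_hom_ring F E \<iota>
    unfolding E_def \<iota>_def by (rule F.quot_const_hom[OF f(1)])
  note sub = F.quot_const_subfield[OF f(1) E.field_axioms[unfolded E_def], folded E_def \<iota>_def]
  \<comment> \<open>The facts about divisors \<open>g\<close> of the binomial are now used with
    \<open>g\<close> the binomial itself.\<close>
  have dvd: "f pdivides\<^bsub>F\<^esub> binomial_poly F n \<xi>"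
    unfolding f(3)[symmetric] pdivides_def
    by (rule monoid.divides_refl[OF F.univ_poly_is_monoid[OF F.carrier_is_subring] f(1)])
  have \<alpha>_n: "\<alpha> [^]\<^bsub>E\<^esub> n = \<iota> \<xi>"
    using F.quot_var_pow[OF f(1) \<xi>(1) dvd] by (simp add: \<alpha>_def E_def \<iota>_def)
  have b: "b \<in> carrier F" "b \<noteq> \<zero>\<^bsub>F\<^esub>" "b [^]\<^bsub>F\<^esub> n \<noteq> \<xi>"
    using assms by (auto simp: n_def)
  have \<iota>_eq_iff: "\<iota> x = \<iota> y \<longleftrightarrow> x = y" if "x \<in> carrier F" "y \<in> carrier F" for x y
    using inj_on_eq_iff[OF sub(1) that] .
  have char: "add_pow F p \<one>\<^bsub>F\<^esub> = \<zero>\<^bsub>F\<^esub>"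
    using F.char_of_prime_power_card \<open>finite (carrier F)\<close> \<open>card (carrier F) = p ^ l\<close> .
  have charE: "add_pow E p \<one>\<^bsub>E\<^esub> = \<zero>\<^bsub>E\<^esub>"
    using I.hom_add_pow[of "\<one>\<^bsub>F\<^esub>" p] char by simp
  \<comment> \<open>As the characteristic is \<open>p\<close> and \<open>n\<close> is a power of
    another prime, \<open>n\<close> times \<open>\<one>\<close> is nonzero in
    \<open>E\<close>.\<close>
  have "coprime p n"
    unfolding n_def using \<open>Factorial_Ring.prime p\<close> \<open>Factorial_Ring.prime q\<close> \<open>p \<noteq> q\<close>
    by (simp add: primes_coprime)
  interpret T: cyclic_twist E "\<iota> ` carrier F" "p ^ l" n \<alpha> "\<iota> \<zeta>" "\<iota> b"
  proof (intro cyclic_twist.intro cyclic_twist_axioms.intro E.field_axioms)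
    show "subfield (\<iota> ` carrier F) E" by (rule sub(2))
    show "\<alpha> \<in> carrier E" unfolding \<alpha>_def E_def by (rule F.quot_var_closed[OF f(1)])
    show "\<iota> \<zeta> \<in> \<iota> ` carrier F" "\<iota> b \<in> \<iota> ` carrier F" using \<zeta> b by auto
    show "\<iota> b \<noteq> \<zero>\<^bsub>E\<^esub>" using \<iota>_eq_iff[of b "\<zero>\<^bsub>F\<^esub>"] b by simp
    show "a [^]\<^bsub>E\<^esub> (p ^ l) = a" if "a \<in> \<iota> ` carrier F" for a
    proof -
      obtain x where x: "x \<in> carrier F" "a = \<iota> x" using \<open>a \<in> _\<close> by blast
      have "x [^]\<^bsub>F\<^esub> (p ^ l) = x"
        using F.power_card_eq_self[OF \<open>finite (carrier F)\<close> x(1)] \<open>card (carrier F) = p ^ l\<close> by simp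
      then show ?thesis using I.hom_nat_pow[OF x(1), of "p ^ l"] x(2) by simp
    qed
    show "(x \<ominus>\<^bsub>E\<^esub> y) [^]\<^bsub>E\<^esub> ((p ^ l) ^ k) = x [^]\<^bsub>E\<^esub> ((p ^ l) ^ k) \<ominus>\<^bsub>E\<^esub> y [^]\<^bsub>E\<^esub> ((p ^ l) ^ k)"
      if "x \<in> carrier E" "y \<in> carrier E" for x y k
      \<comment> \<open>Iterates of the Frobenius map of \<open>F\<close> are powers of the
        \<open>p\<close>-th power map, with exponent \<open>p ^ (l * k)\<close>.\<close>
      using E.minus_power_prime_power_char[OF \<open>Factorial_Ring.prime p\<close> charE that, of "l * k"]
      by (simp only: power_mult)
    show "\<alpha> [^]\<^bsub>E\<^esub> (p ^ l) = \<iota> \<zeta> \<otimes>\<^bsub>E\<^esub> \<alpha>"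
      using F.quot_var_frobenius[OF f(1) \<xi>(1) dvd, of M] unfolding N \<zeta>_eq \<alpha>_def E_def \<iota>_def .
    show "\<alpha> [^]\<^bsub>E\<^esub> n \<in> \<iota> ` carrier F" using \<alpha>_n \<xi>(1) by simp
    show "\<alpha> [^]\<^bsub>E\<^esub> n \<noteq> \<iota> b [^]\<^bsub>E\<^esub> n"
      using \<alpha>_n \<iota>_eq_iff[of \<xi> "b [^]\<^bsub>F\<^esub> n"] \<xi>(1) b I.hom_nat_pow[OF b(1), of n] by auto
    show "\<iota> \<zeta> [^]\<^bsub>E\<^esub> n = \<one>\<^bsub>E\<^esub>"
      using I.hom_nat_pow[OF \<zeta>, of n] \<zeta>_n by simp
    show "\<iota> \<zeta> [^]\<^bsub>E\<^esub> i \<noteq> \<one>\<^bsub>E\<^esub>" if "0 < i" "i < n" for i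
      using I.hom_nat_pow[OF \<zeta>, of i] \<zeta>_ne[OF that] \<iota>_eq_iff[of "\<zeta> [^]\<^bsub>F\<^esub> i" "\<one>\<^bsub>F\<^esub>"] \<zeta> by simp
    show "n > 0" by (rule n)
    show "add_pow E n \<one>\<^bsub>E\<^esub> \<noteq> \<zero>\<^bsub>E\<^esub>"
      by (rule E.add_pow_coprime_nonzero[OF E.one_not_zero charE \<open>coprime p n\<close>])
    show "V = carrier E" if "subalgebra (\<iota> ` carrier F) V E" "\<one>\<^bsub>E\<^esub> \<in> V"
      "\<And>v. v \<in> V \<Longrightarrow> \<alpha> \<otimes>\<^bsub>E\<^esub> v \<in> V" for V
      using F.quot_generated[OF f(1), of V] that unfolding E_def \<iota>_def \<alpha>_def by blast
    show "E.dimension n (\<iota> ` carrier F) (carrier E)"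
      using F.quot_dimension[OF f(1)] f(2) n unfolding E_def \<iota>_def by simp
  qed
  have \<gamma>: "T.\<gamma> = \<gamma>" by (simp add: T.\<gamma>_def \<gamma>_def)
  have pow: "(p ^ l) ^ i = p ^ (i * l)" for i
    by (simp add: mult.commute flip: power_mult)
  have basis: "is_basis E (\<iota> ` carrier F) (map (\<lambda>i. \<gamma> [^]\<^bsub>E\<^esub> (p ^ (i * l))) [0..<n])"
    using T.basis unfolding \<gamma> pow .
  \<comment> \<open>The conjugates in \<open>normal_element\<close> are formed with the cardinality
    of the embedded copy of \<open>F\<close>, which injectivity of \<iota> identifies with
    \<open>p ^ l\<close>.\<close>
  have card: "card (\<iota> ` carrier F) = p ^ l"
    using card_image[OF sub(1)] \<open>card (carrier F) = p ^ l\<close> by simp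
  have normal: "normal_element E (\<iota> ` carrier F) \<gamma>"
    unfolding normal_element_def card pow using T.dim basis T.\<gamma>_in_carrier unfolding \<gamma> by blast
  have relation: "\<iota> (\<zeta> [^]\<^bsub>F\<^esub> i \<ominus>\<^bsub>F\<^esub> \<one>\<^bsub>F\<^esub>) \<otimes>\<^bsub>E\<^esub> \<iota> b \<otimes>\<^bsub>E\<^esub> \<gamma> [^]\<^bsub>E\<^esub> (1 + p ^ (i * l))
      = \<gamma> \<ominus>\<^bsub>E\<^esub> \<iota> (\<zeta> [^]\<^bsub>F\<^esub> i) \<otimes>\<^bsub>E\<^esub> \<gamma> [^]\<^bsub>E\<^esub> (p ^ (i * l))" for i :: nat
  proof -
    have "\<iota> (\<zeta> [^]\<^bsub>F\<^esub> i \<ominus>\<^bsub>F\<^esub> \<one>\<^bsub>F\<^esub>) = \<iota> \<zeta> [^]\<^bsub>E\<^esub> i \<ominus>\<^bsub>E\<^esub> \<one>\<^bsub>E\<^esub>"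
      using \<zeta> I.hom_nat_pow[OF \<zeta>, of i] by (simp add: F.minus_eq E.minus_eq)
    then show ?thesis
      using T.relation[of i] I.hom_nat_pow[OF \<zeta>, of i] unfolding \<gamma> pow by simp
  qed
  have "(\<Oplus>\<^bsub>E\<^esub>i\<in>{0..n - 1}. \<gamma> [^]\<^bsub>E\<^esub> (p ^ (i * l)))
      = \<ominus>\<^bsub>E\<^esub> add_pow E n (\<iota> b [^]\<^bsub>E\<^esub> (n - 1) \<otimes>\<^bsub>E\<^esub> inv\<^bsub>E\<^esub> (\<iota> b [^]\<^bsub>E\<^esub> n \<ominus>\<^bsub>E\<^esub> \<iota> \<xi>))"
    using T.trace unfolding \<gamma> pow \<alpha>_n atLeast0AtMost .
  also have "\<dots> = \<iota> (\<ominus>\<^bsub>F\<^esub> add_pow F n (b [^]\<^bsub>F\<^esub> (n - 1)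
      \<otimes>\<^bsub>F\<^esub> inv\<^bsub>F\<^esub> (b [^]\<^bsub>F\<^esub> n \<ominus>\<^bsub>F\<^esub> \<xi>)))"
  proof -
    let ?u = "b [^]\<^bsub>F\<^esub> n \<ominus>\<^bsub>F\<^esub> \<xi>"
    have u: "?u \<in> Units F" using b \<xi>(1) by (simp add: F.field_Units)
    have uE: "\<iota> ?u = \<iota> b [^]\<^bsub>E\<^esub> n \<ominus>\<^bsub>E\<^esub> \<iota> \<xi>"
      using b(1) \<xi>(1) I.hom_nat_pow[OF b(1), of n] by (simp add: F.minus_eq E.minus_eq)
    have uc: "?u \<in> carrier F" "inv\<^bsub>F\<^esub> ?u \<in> carrier F" "?u \<otimes>\<^bsub>F\<^esub> inv\<^bsub>F\<^esub> ?u = \<one>\<^bsub>F\<^esub>"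
      using u by auto
    \<comment> \<open>A ring homomorphism sends the inverse of a unit to an inverse of its image, so
      the formula computed in \<open>E\<close> is the image of one in \<open>F\<close>.\<close>
    have "\<iota> ?u \<otimes>\<^bsub>E\<^esub> \<iota> (inv\<^bsub>F\<^esub> ?u) = \<one>\<^bsub>E\<^esub>"
      using I.hom_mult[OF uc(1,2)] uc(3) by simp
    then have "inv\<^bsub>E\<^esub> (\<iota> ?u) = \<iota> (inv\<^bsub>F\<^esub> ?u)"
      using uc by (intro E.comm_inv_char) auto
    then show ?thesis
      using b(1) uc(2) I.hom_nat_pow[OF b(1), of "n - 1"]
      unfolding uE[symmetric] by (simp add: I.hom_add_pow)
  qed
  finally show ?thesis
    using irr normal basis relation \<zeta>_ne unfolding n_def by auto
qed

end
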